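(* Let $$F=\frac12\sum_{i,j=1}^N c_ic_jf(\boldsymbol{d}_i-\boldsymbol{d}_j)x_ix_j$$ be the Hamiltonian (without bias term) of a two-dimensional periodic spQUBO with spatial shape $\boldsymbol{L}=(L_1,L_2)$, evaluated at $x_1,\dots,x_N\in\{0,1\}$. Define $\xi\colon\mathbb{Z}^2\to\mathbb{R}$ to be the function with period $\boldsymbol{L}$ given for $\boldsymbol{x}\in[\boldsymbol{L})$ by $\xi(\boldsymbol{x})=c_ix_i$ if $\boldsymbol{x}=\boldsymbol{d}_i$ for some $i$, and $\xi(\boldsymbol{x})=0$ otherwise. Then $$F=\frac{1}{2V}\sum_{\boldsymbol{k}\in[\boldsymbol{L})}\|\mathcal{F}[\xi](\boldsymbol{k})\|^2\,\mathcal{F}[f](\boldsymbol{k}),$$ where $V=L_1L_2$ is the spatial volume, $\mathcal{F}$ denotes the discrete Fourier transform and $\|\cdot\|$ the complex modulus.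
   Context: For $\boldsymbol{L}\in\mathbb{N}^2$ (positive entries), $[\boldsymbol{L})=\{\boldsymbol{d}\in\mathbb{Z}^2\mid \boldsymbol{0}\le\boldsymbol{d}<\boldsymbol{L}\}$ with element-wise inequalities. A function $\phi$ on $\mathbb{Z}^2$ has period $\boldsymbol{L}$ if $\phi(\boldsymbol{d})=\phi(\boldsymbol{d}+\boldsymbol{k}\odot\boldsymbol{L})$ for all $\boldsymbol{d},\boldsymbol{k}\in\mathbb{Z}^2$, where $\odot$ is the element-wise product. A two-dimensional periodic spQUBO (without bias) with spatial shape $\boldsymbol{L}$ is given by a function $f\colon\mathbb{Z}^2\to\mathbb{R}$ (the spatial coupling function) that is symmetric, $f(\boldsymbol{d})=f(-\boldsymbol{d})$, and has period $\boldsymbol{L}$, together with coefficients $c_i\in\mathbb{R}$ and pairwise distinct grid points $\boldsymbol{d}_i\in[\boldsymbol{L})$ for $i=1,\dots,N$; its objective (Hamiltonian), as a function of $x_1,\dots,x_N\in\{0,1\}$, is $\frac12\sum_{i,j}c_ic_jf(\boldsymbol{d}_i-\boldsymbol{d}_j)x_ix_j$. For $\phi$ on $\mathbb{Z}^2$ with period $\boldsymbol{L}$, the discrete Fourier transform is $\mathcal{F}[\phi](\boldsymbol{k})=\sum_{\boldsymbol{x}\in[\boldsymbol{L})}\phi(\boldsymbol{x})\exp\left(-2\pi\mathrm{i}\sum_{d=1}^2 k_dx_d/L_d\right)$. *)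

theory Defs
  imports "HOL-Analysis.Analysis"
begin

definition grid :: "int \<times> int \<Rightarrow> (int \<times> int) set" where
  "grid L = {0..<fst L} \<times> {0..<snd L}"

definition hadamard :: "int \<times> int \<Rightarrow> int \<times> int \<Rightarrow> int \<times> int" (infixl "\<odot>" 70) where
  "k \<odot> L = (fst k * fst L, snd k * snd L)"

definition has_period :: "int \<times> int \<Rightarrow> (int \<times> int \<Rightarrow> 'a) \<Rightarrow> bool" where
  "has_period L \<phi> \<longleftrightarrow> (\<forall>d k. \<phi> d = \<phi> (d + k \<odot> L))"

definition dft :: "int \<times> int \<Rightarrow> (int \<times> int \<Rightarrow> complex) \<Rightarrow> int \<times> int \<Rightarrow> complex" where
  "dft L \<phi> k = (\<Sum>x\<in>grid L. \<phi> x *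
     exp (- 2 * of_real pi * \<i> *
       (of_int (fst k * fst x) / of_int (fst L) + of_int (snd k * snd x) / of_int (snd L))))"

text \<open>
  The variables are indexed by \<open>i \<in> {1..N}\<close>; \<open>c\<close>, \<open>d\<close> and \<open>x\<close> are unconstrained outside this
  range. The coefficients \<open>c\<close> are arbitrary reals, so they do not occur in the predicate.
\<close>

definition periodic_spqubo ::
    "int \<times> int \<Rightarrow> nat \<Rightarrow> (int \<times> int \<Rightarrow> real) \<Rightarrow> (nat \<Rightarrow> int \<times> int) \<Rightarrow> bool" where
  "periodic_spqubo L N f d \<longleftrightarrow>
     0 < fst L \<and> 0 < snd L \<and>
     (\<forall>z. f z = f (- z)) \<and> has_period L f \<and>
     (\<forall>i\<in>{1..N}. d i \<in> grid L) \<and> inj_on d {1..N}"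

definition spqubo_hamiltonian ::
    "nat \<Rightarrow> (int \<times> int \<Rightarrow> real) \<Rightarrow> (nat \<Rightarrow> real) \<Rightarrow> (nat \<Rightarrow> int \<times> int) \<Rightarrow> (nat \<Rightarrow> real) \<Rightarrow> real" where
  "spqubo_hamiltonian N f c d x =
     1 / 2 * (\<Sum>i=1..N. \<Sum>j=1..N. c i * c j * f (d i - d j) * x i * x j)"

text \<open>
  \<open>grid_rep L z\<close> is the point of \<open>grid L\<close> congruent to \<open>z\<close> modulo the period; composing with it
  extends a function given on \<open>grid L\<close> periodically. The description operator in \<open>spqubo_field\<close> is
  well defined for distinct grid points; the lemmas below confirm the intended values.
\<close>

definition grid_rep :: "int \<times> int \<Rightarrow> int \<times> int \<Rightarrow> int \<times> int" where
  "grid_rep L z = (fst z mod fst L, snd z mod snd L)"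

definition spqubo_field ::
    "int \<times> int \<Rightarrow> nat \<Rightarrow> (nat \<Rightarrow> real) \<Rightarrow> (nat \<Rightarrow> int \<times> int) \<Rightarrow> (nat \<Rightarrow> real) \<Rightarrow> int \<times> int \<Rightarrow> real" where
  "spqubo_field L N c d x z =
     (if \<exists>i\<in>{1..N}. grid_rep L z = d i
      then let i = (THE i. i \<in> {1..N} \<and> grid_rep L z = d i) in c i * x i
      else 0)"

lemma grid_rep_eq: "z \<in> grid L \<Longrightarrow> grid_rep L z = z"
  by (auto simp: grid_rep_def grid_def prod_eq_iff)

lemma has_period_spqubo_field: "has_period L (spqubo_field L N c d x)"
proof -
  have "grid_rep L (z + k \<odot> L) = grid_rep L z" for z k
    by (simp add: grid_rep_def hadamard_def)
  then show ?thesis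
    by (simp add: has_period_def spqubo_field_def)
qed

lemma spqubo_field_at_point:
  assumes "periodic_spqubo L N f d" "i \<in> {1..N}"
  shows "spqubo_field L N c d x (d i) = c i * x i"
proof -
  have "grid_rep L (d i) = d i"
    using assms by (intro grid_rep_eq) (auto simp: periodic_spqubo_def)
  moreover have "(THE j. j \<in> {1..N} \<and> d i = d j) = i"
    using assms by (intro the_equality) (auto simp: periodic_spqubo_def dest: inj_onD)
  ultimately show ?thesis
    using assms(2) by (auto simp: spqubo_field_def Let_def)
qed

lemma spqubo_field_off_points:
  assumes "z \<in> grid L" "\<And>i. i \<in> {1..N} \<Longrightarrow> z \<noteq> d i"
  shows "spqubo_field L N c d x z = 0"
  using assms by (auto simp: spqubo_field_def grid_rep_eq)

end

theory Submission
  imports Defs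
begin

text \<open>
  Substituting the Fourier inversion formula for \<open>f (d i - d j)\<close> into the Hamiltonian turns the
  double sum over \<open>i, j\<close> into a product of the transform of the field and its conjugate.
  Inversion rests on the orthogonality of the characters of the finite group of the grid.
\<close>

text \<open>The kernel of \<open>dft\<close>, named separately because the proof works with its
  group structure: for fixed \<open>k\<close> it is a character of the additive group of integer
  pairs.\<close>

definition dft_char :: "int \<times> int \<Rightarrow> int \<times> int \<Rightarrow> int \<times> int \<Rightarrow> complex" where
  "dft_char L k z = exp (- 2 * of_real pi * \<i> *
     (of_int (fst k * fst z) / of_int (fst L) + of_int (snd k * snd z) / of_int (snd L)))"

lemma dft_eq_sum_dft_char: "dft L \<phi> k = (\<Sum>z\<in>grid L. \<phi> z * dft_char L k z)"
  by (simp add: dft_def dft_char_def)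

lemma dft_char_add: "dft_char L k (y + z) = dft_char L k y * dft_char L k z"
  unfolding dft_char_def exp_add[symmetric]
  by (simp add: algebra_simps add_divide_distrib)

text \<open>The exponent is purely imaginary, so negating it amounts to conjugation.\<close>

lemma dft_char_minus: "dft_char L k (- z) = cnj (dft_char L k z)"
  by (simp add: dft_char_def exp_cnj algebra_simps)

lemma dft_char_diff: "dft_char L k (y - z) = dft_char L k y * cnj (dft_char L k z)"
  using dft_char_add[of L k y "- z"] by (simp add: dft_char_minus)

lemma finite_grid: "finite (grid L)"
  by (simp add: grid_def)

text \<open>The summands are the powers of an \<open>n\<close>-th root of unity \<open>w\<close>.
  Their geometric sum vanishes unless \<open>w = 1\<close>, which happens exactly when
  \<open>n\<close> divides \<open>m\<close>.\<close>

lemma sum_exp_eq_if_dvd: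
  fixes n m :: int
  assumes "0 < n"
  shows "(\<Sum>j\<in>{0..<n}. exp (- 2 * of_real pi * \<i> * (of_int (j * m) / of_int n))) =
    (if n dvd m then of_int n else (0 :: complex))"
proof -
  define w :: complex where "w = exp (- 2 * of_real pi * \<i> * (of_int m / of_int n))"
  have w_power: "w ^ j = exp (- 2 * of_real pi * \<i> * (of_int (int j * m) / of_int n))" for j
    by (simp add: w_def exp_of_nat_mult[symmetric] mult_ac)
  have w_eq_1: "w = 1 \<longleftrightarrow> n dvd m"
  proof
    assume "w = 1"
    \<comment> \<open>\<open>exp_eq_1\<close> makes the imaginary part of the exponent a multiple of
      2 \<pi>; the minus sign in the kernel turns the quotient \<open>m / n\<close> into
      \<open>- t\<close>.\<close>
    then obtain t :: int where "- 2 * pi * (of_int m / of_int n) = of_int (2 * t) * pi"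
      by (auto simp: w_def exp_eq_1)
    then have "pi * real_of_int m = pi * of_int (n * - t)"
      using assms by (simp add: field_simps)
    then have "real_of_int m = of_int (n * - t)"
      by (simp only: mult_cancel_left pi_neq_zero simp_thms)
    then show "n dvd m"
      unfolding of_int_eq_iff by simp
  next
    assume "n dvd m"
    then obtain t where "m = n * t" ..
    then have "w = exp (2 * of_int (- t) * of_real pi * \<i>)"
      using assms by (simp add: w_def mult_ac)
    then show "w = 1"
      using exp_integer_2pi[of "of_int (- t)"] by (simp add: mult_ac)
  qed
  have "w ^ nat n = exp (2 * of_int (- m) * of_real pi * \<i>)"
    using assms by (simp add: w_power mult_ac)
  then have w_n: "w ^ nat n = 1"
    using exp_integer_2pi[of "of_int (- m)"] by (simp add: mult_ac)
  have "(\<Sum>j\<in>{0..<n}. exp (- 2 * of_real pi * \<i> * (of_int (j * m) / of_int n))) = (\<Sum>j<nat n. w ^ j)"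
    by (rule sum.reindex_bij_witness[where i = int and j = nat]) (auto simp: w_power)
  also have "\<dots> = (if n dvd m then of_int n else 0)"
    using assms w_n by (simp add: sum_gp_strict w_eq_1)
  finally show ?thesis .
qed

text \<open>Orthogonality of characters: the kernel is a product of one factor per coordinate, so
  the sum over the grid splits into two one-dimensional sums.\<close>

lemma sum_dft_char:
  assumes "0 < fst L" "0 < snd L"
  shows "(\<Sum>k\<in>grid L. dft_char L k z) =
    (if fst L dvd fst z \<and> snd L dvd snd z then of_int (fst L * snd L) else 0)"
proof -
  have "(\<Sum>k\<in>grid L. dft_char L k z) =
    (\<Sum>j\<in>{0..<fst L}. exp (- 2 * of_real pi * \<i> * (of_int (j * fst z) / of_int (fst L)))) *
    (\<Sum>j\<in>{0..<snd L}. exp (- 2 * of_real pi * \<i> * (of_int (j * snd z) / of_int (snd L))))"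
    unfolding grid_def sum_product sum.cartesian_product dft_char_def
    by (intro sum.cong refl) (auto simp: exp_add[symmetric] algebra_simps)
  then show ?thesis
    unfolding sum_exp_eq_if_dvd[OF assms(1)] sum_exp_eq_if_dvd[OF assms(2)] by simp
qed

lemma has_period_grid_rep:
  assumes "has_period L \<phi>"
  shows "\<phi> (grid_rep L z) = \<phi> z"
proof -
  have "z = grid_rep L z + (fst z div fst L, snd z div snd L) \<odot> L"
    by (simp add: grid_rep_def hadamard_def prod_eq_iff)
  then show ?thesis
    using assms unfolding has_period_def by metis
qed

text \<open>By orthogonality, summing over \<open>k\<close> first leaves only the grid point
  congruent to \<open>z\<close>. The point \<open>z\<close> is not confined to the grid, since a
  difference \<open>d i - d j\<close> may lie outside it.\<close>

lemma dft_inversion: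
  assumes "0 < fst L" "0 < snd L" "has_period L \<phi>"
  shows "(\<Sum>k\<in>grid L. dft L \<phi> k * cnj (dft_char L k z)) = of_int (fst L * snd L) * \<phi> z"
proof -
  have congruent: "fst L dvd fst (y - z) \<and> snd L dvd snd (y - z) \<longleftrightarrow> y = grid_rep L z"
    if "y \<in> grid L" for y
  proof -
    have "grid_rep L y = y"
      using that by (rule grid_rep_eq)
    then show ?thesis
      by (auto simp: grid_rep_def prod_eq_iff mod_eq_dvd_iff[symmetric])
  qed
  have "(\<Sum>k\<in>grid L. dft L \<phi> k * cnj (dft_char L k z)) =
    (\<Sum>k\<in>grid L. \<Sum>y\<in>grid L. \<phi> y * dft_char L k (y - z))"
    by (simp add: dft_eq_sum_dft_char sum_distrib_left sum_distrib_right dft_char_diff mult_ac)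
  also have "\<dots> = (\<Sum>y\<in>grid L. \<phi> y * (\<Sum>k\<in>grid L. dft_char L k (y - z)))"
    by (subst sum.swap) (simp add: sum_distrib_left)
  also have "\<dots> = (\<Sum>y\<in>grid L. if y = grid_rep L z then \<phi> y * of_int (fst L * snd L) else 0)"
    \<comment> \<open>The two deleted rules would split \<open>fst (y - z)\<close> and
      \<open>snd (y - z)\<close>, and \<open>congruent\<close> would no longer match.\<close>
    by (intro sum.cong refl) (simp add: sum_dft_char[OF assms(1,2)] congruent del: fst_diff snd_diff)
  also have "\<dots> = \<phi> (grid_rep L z) * of_int (fst L * snd L)"
    using assms(1,2) finite_grid[of L] by (simp add: grid_rep_def grid_def)
  finally show ?thesis
    using has_period_grid_rep[OF assms(3)] by (simp add: mult.commute)
qed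

text \<open>The field vanishes off the points \<open>d i\<close>, and these are distinct, so the sum
  over the grid becomes a sum over indices.\<close>

lemma dft_spqubo_field:
  assumes "periodic_spqubo L N f d"
  shows "dft L (\<lambda>z. complex_of_real (spqubo_field L N c d x z)) k =
    (\<Sum>i=1..N. of_real (c i * x i) * dft_char L k (d i))"
proof -
  have inj: "inj_on d {1..N}" and sub: "d ` {1..N} \<subseteq> grid L"
    using assms by (auto simp: periodic_spqubo_def)
  have "dft L (\<lambda>z. complex_of_real (spqubo_field L N c d x z)) k =
    (\<Sum>z\<in>d ` {1..N}. of_real (spqubo_field L N c d x z) * dft_char L k z)"
    unfolding dft_eq_sum_dft_char
    by (rule sum.mono_neutral_right[OF finite_grid sub])
      (auto intro!: spqubo_field_off_points)
  also have "\<dots> = (\<Sum>i=1..N. of_real (c i * x i) * dft_char L k (d i))"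
    by (simp add: sum.reindex[OF inj] spqubo_field_at_point[OF assms] del: One_nat_def)
  finally show ?thesis .
qed

theorem theorem3:
  fixes L :: "int \<times> int" and N :: nat and f :: "int \<times> int \<Rightarrow> real"
    and c :: "nat \<Rightarrow> real" and d :: "nat \<Rightarrow> int \<times> int" and x :: "nat \<Rightarrow> real"
  assumes "periodic_spqubo L N f d"
    and "\<forall>i\<in>{1..N}. x i \<in> {0, 1}"
  shows "complex_of_real (spqubo_hamiltonian N f c d x) =
    1 / (2 * of_int (fst L * snd L)) *
      (\<Sum>k\<in>grid L.
        complex_of_real ((cmod (dft L (\<lambda>z. complex_of_real (spqubo_field L N c d x z)) k))\<^sup>2) *
        dft L (\<lambda>z. complex_of_real (f z)) k)"
proof -
  let ?\<xi> = "dft L (\<lambda>z. complex_of_real (spqubo_field L N c d x z))"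
  let ?f = "dft L (\<lambda>z. complex_of_real (f z))"
  let ?a = "\<lambda>i. complex_of_real (c i * x i)"
  let ?V = "complex_of_int (fst L * snd L)"
  have L: "0 < fst L" "0 < snd L" and "has_period L f"
    using assms(1) by (auto simp: periodic_spqubo_def)
  then have period: "has_period L (\<lambda>z. complex_of_real (f z))"
    by (simp add: has_period_def)
  have "of_real ((cmod (?\<xi> k))\<^sup>2) * ?f k =
    (\<Sum>i=1..N. \<Sum>j=1..N. ?a i * ?a j * (?f k * cnj (dft_char L k (d i - d j))))" for k
  proof -
    \<comment> \<open>The conjugate factor comes first so that the kernels at \<open>d i\<close> and
      \<open>d j\<close> combine to the conjugated kernel at \<open>d i - d j\<close>, the form that
      \<open>dft_inversion\<close> expects.\<close>
    have "of_real ((cmod (?\<xi> k))\<^sup>2) = cnj (?\<xi> k) * ?\<xi> k"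
      by (subst complex_norm_square) (rule mult.commute)
    also have "\<dots> = (\<Sum>i=1..N. \<Sum>j=1..N. ?a i * ?a j * cnj (dft_char L k (d i - d j)))"
      unfolding dft_spqubo_field[OF assms(1)] cnj_sum sum_product
      by (intro sum.cong refl) (simp add: dft_char_diff)
    finally show ?thesis
      by (simp only: sum_distrib_left sum_distrib_right mult_ac)
  qed
  then have "(\<Sum>k\<in>grid L. of_real ((cmod (?\<xi> k))\<^sup>2) * ?f k) =
    (\<Sum>k\<in>grid L. \<Sum>i=1..N. \<Sum>j=1..N. ?a i * ?a j * (?f k * cnj (dft_char L k (d i - d j))))"
    by simp
  also have "\<dots> = (\<Sum>i=1..N. \<Sum>j=1..N.
      ?a i * ?a j * (\<Sum>k\<in>grid L. ?f k * cnj (dft_char L k (d i - d j))))"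
    \<comment> \<open>The sum over \<open>k\<close> moves innermost, where it is the inversion sum
      for \<open>f\<close> at \<open>d i - d j\<close>.\<close>
    by (simp only: sum_distrib_left sum.swap[of _ _ "grid L"])
  also have "\<dots> = (\<Sum>i=1..N. \<Sum>j=1..N. ?a i * ?a j * (?V * of_real (f (d i - d j))))"
    by (simp only: dft_inversion[OF L period])
  also have "\<dots> = 2 * ?V * of_real (spqubo_hamiltonian N f c d x)"
    by (simp add: spqubo_hamiltonian_def sum_distrib_left mult_ac)
  \<comment> \<open>Positivity of both side lengths makes \<open>?V\<close> nonzero, so the factor
    \<open>2 * ?V\<close> can be divided out.\<close>
  finally show ?thesis
    using L by simp
qed

end
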